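(* Let $G$ be a finite group which is the internal central product $G = U_1U_2$ of subgroups $U_1, U_2 \leq G$, where either $U_1$ or $U_2$ is solvable. Let $D = U_1\times U_2$ be the external direct product, let $\overline{U}_1=\{(u_1,1) : u_1\in U_1\}$ and $\overline{U}_2=\{(1,u_2) : u_2\in U_2\}$, and let $\varepsilon : D \to G$ be an epimorphism with $\varepsilon(\overline{U}_i)=U_i$ for $i=1,2$. If $H=V_1V_2$ is a subgroup of $G$ such that $V_i\leq U_i$ for $i=1,2$ and $\varepsilon^{-1}(H)=V_1\times V_2$ contains $\ker\varepsilon$, then $H$ is abnormal in $G$ if and only if $V_i$ is abnormal in $U_i$ for $i = 1,2$.
   Context: $G$ is an internal central product of subgroups $U_1,U_2\leq G$ if $G=U_1U_2$ and $[U_1,U_2]=1$. A subgroup $H\leq G$ is abnormal in $G$ if $g\in\langle H,H^{g}\rangle$ for all $g\in G$, where $H^g=g^{-1}Hg$. $\varepsilon^{-1}(H)$ is the full preimage of $H$. *)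

theory Defs
  imports "HOL-Algebra.Algebra"
begin

definition commutator_subgroup ::
  "('a, 'b) monoid_scheme \<Rightarrow> 'a set \<Rightarrow> 'a set \<Rightarrow> 'a set" where
  "commutator_subgroup G A B =
     generate G {inv\<^bsub>G\<^esub> a \<otimes>\<^bsub>G\<^esub> inv\<^bsub>G\<^esub> b \<otimes>\<^bsub>G\<^esub> a \<otimes>\<^bsub>G\<^esub> b | a b. a \<in> A \<and> b \<in> B}"

definition internal_central_product ::
  "('a, 'b) monoid_scheme \<Rightarrow> 'a set \<Rightarrow> 'a set \<Rightarrow> bool" where
  "internal_central_product G U\<^sub>1 U\<^sub>2 \<longleftrightarrow>
     subgroup U\<^sub>1 G \<and> subgroup U\<^sub>2 G \<and> carrier G = U\<^sub>1 <#>\<^bsub>G\<^esub> U\<^sub>2 \<and>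
     commutator_subgroup G U\<^sub>1 U\<^sub>2 = {\<one>\<^bsub>G\<^esub>}"

definition conjugate_set :: "('a, 'b) monoid_scheme \<Rightarrow> 'a set \<Rightarrow> 'a \<Rightarrow> 'a set" where
  "conjugate_set G H g = (\<lambda>h. inv\<^bsub>G\<^esub> g \<otimes>\<^bsub>G\<^esub> h \<otimes>\<^bsub>G\<^esub> g) ` H"

definition abnormal :: "'a set \<Rightarrow> ('a, 'b) monoid_scheme \<Rightarrow> bool" where
  "abnormal H G \<longleftrightarrow>
     subgroup H G \<and> (\<forall>g\<in>carrier G. g \<in> generate G (H \<union> conjugate_set G H g))"

end

theory Submission
  imports Defs
begin

text \<open>
  Conjugating a subset of \<open>U\<^sub>1\<close> by \<open>u\<^sub>1u\<^sub>2\<close> is the same as conjugating it by \<open>u\<^sub>1\<close>, and likewise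
  for \<open>U\<^sub>2\<close>. Hence \<open>\<langle>H, H\<^sup>g\<rangle>\<close> with \<open>g = u\<^sub>1u\<^sub>2\<close> contains \<open>\<langle>V\<^sub>i, V\<^sub>i\<^sup>u\<rangle>\<close> for \<open>u = u\<^sub>i\<close>, so abnormality
  of both \<open>V\<^sub>i\<close> gives that of \<open>H\<close>. Conversely, for \<open>g \<in> U\<^sub>1\<close> one has
  \<open>\<langle>H, H\<^sup>g\<rangle> \<subseteq> \<langle>V\<^sub>1, V\<^sub>1\<^sup>g\<rangle>V\<^sub>2\<close>, so \<open>g\<close> differs from an element of \<open>\<langle>V\<^sub>1, V\<^sub>1\<^sup>g\<rangle>\<close> by one of
  \<open>U\<^sub>1 \<inter> V\<^sub>2 \<subseteq> U\<^sub>1 \<inter> H\<close>. The epimorphism enters only to show \<open>U\<^sub>i \<inter> H = V\<^sub>i\<close>: it maps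
  \<open>V\<^sub>i\<close> onto \<open>U\<^sub>i \<inter> H\<close>, which contains \<open>V\<^sub>i\<close>, and \<open>V\<^sub>i\<close> is finite.
\<close>

section \<open>Commutation, conjugation and products of commuting subgroups\<close>

lemma (in group) commute_if_commutator_subgroup_trivial:
  assumes "A \<subseteq> carrier G" "B \<subseteq> carrier G" "commutator_subgroup G A B = {\<one>}" "a \<in> A" "b \<in> B"
  shows "a \<otimes> b = b \<otimes> a"
proof -
  have ab: "a \<in> carrier G" "b \<in> carrier G"
    using assms by auto
  have "inv a \<otimes> inv b \<otimes> a \<otimes> b \<in> commutator_subgroup G A B"
    using assms(4,5) unfolding commutator_subgroup_def by (intro generate.incl) blast
  \<comment> \<open>The commutator, regrouped as the quotient of the two products to be
    compared.\<close>
  then have "inv (b \<otimes> a) \<otimes> (a \<otimes> b) = \<one>"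
    using assms(3) ab by (simp add: inv_mult_group m_assoc)
  then show ?thesis
    using ab by (metis inv_closed inv_equality inv_inv m_closed)
qed

text \<open>The generators all lie in \<open>U\<close>, where inverses, conjugates and generated
  subgroups agree with those of \<open>G\<close>. All later arguments can therefore take place in
  \<open>G\<close>.\<close>

lemma (in group) abnormal_in_subgroup_iff:
  assumes "subgroup U G" "subgroup V (G\<lparr>carrier := U\<rparr>)"
  shows "abnormal V (G\<lparr>carrier := U\<rparr>) \<longleftrightarrow> (\<forall>g\<in>U. g \<in> generate G (V \<union> conjugate_set G V g))"
proof -
  have VU: "V \<subseteq> U"
    using subgroup.subset[OF assms(2)] by simp
  have "generate (G\<lparr>carrier := U\<rparr>) (V \<union> conjugate_set (G\<lparr>carrier := U\<rparr>) V g)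
      = generate G (V \<union> conjugate_set G V g)" if g: "g \<in> U" for g
  proof -
    have conj_eq: "conjugate_set (G\<lparr>carrier := U\<rparr>) V g = conjugate_set G V g"
      using g assms(1) by (simp add: conjugate_set_def)
    have "conjugate_set G V g \<subseteq> U"
      using g VU assms(1)
      by (auto simp: conjugate_set_def intro!: subgroup.m_closed subgroup.m_inv_closed)
    then show ?thesis
      using VU assms(1) by (simp add: conj_eq generate_consistent)
  qed
  then show ?thesis
    using assms(2) by (simp add: abnormal_def)
qed

lemma (in group) subgroup_commuting_set_mult:
  assumes K: "subgroup K G" and V: "subgroup V G"
    and comm: "\<And>k v. \<lbrakk>k \<in> K; v \<in> V\<rbrakk> \<Longrightarrow> k \<otimes> v = v \<otimes> k"
  shows "subgroup (K <#> V) G"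
proof (rule subgroupI)
  note carr = subgroup.mem_carrier[OF K] subgroup.mem_carrier[OF V]
  show "K <#> V \<subseteq> carrier G"
    using carr by (auto simp: set_mult_def)
  show "K <#> V \<noteq> {}"
    using subgroup.one_closed[OF K] subgroup.one_closed[OF V] by (auto simp: set_mult_def)
  show "inv x \<in> K <#> V" if x: "x \<in> K <#> V" for x
  proof -
    obtain k v where kv: "k \<in> K" "v \<in> V" "x = k \<otimes> v"
      using x by (auto simp: set_mult_def)
    then have "x = v \<otimes> k"
      using comm by simp
    then have "inv x = inv k \<otimes> inv v"
      using kv carr by (simp add: inv_mult_group)
    then show ?thesis
      using subgroup.m_inv_closed[OF K kv(1)] subgroup.m_inv_closed[OF V kv(2)]
      by (auto simp: set_mult_def)
  qed
  show "x \<otimes> y \<in> K <#> V" if xy: "x \<in> K <#> V" "y \<in> K <#> V" for x y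
  proof -
    obtain k v k' v' where kv: "k \<in> K" "v \<in> V" "x = k \<otimes> v" "k' \<in> K" "v' \<in> V" "y = k' \<otimes> v'"
      using xy by (auto simp: set_mult_def)
    have "x \<otimes> y = k \<otimes> (v \<otimes> k') \<otimes> v'"
      using kv carr by (simp add: m_assoc)
    also have "\<dots> = k \<otimes> (k' \<otimes> v) \<otimes> v'"
      using comm[OF kv(4) kv(2)] by simp
    also have "\<dots> = (k \<otimes> k') \<otimes> (v \<otimes> v')"
      using kv carr by (simp add: m_assoc)
    finally show ?thesis
      using subgroup.m_closed[OF K kv(1,4)] subgroup.m_closed[OF V kv(2,5)]
      by (auto simp: set_mult_def)
  qed
qed

lemma (in group) commuting_set_mult_commute:
  assumes "\<And>a b. \<lbrakk>a \<in> A; b \<in> B\<rbrakk> \<Longrightarrow> a \<otimes> b = b \<otimes> a"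
  shows "A <#> B = B <#> A"
proof -
  have "A <#> B = (\<Union>a\<in>A. \<Union>b\<in>B. {b \<otimes> a})"
    unfolding set_mult_def using assms by (intro SUP_cong refl) simp
  then show ?thesis
    by (auto simp: set_mult_def)
qed

lemma (in group) subset_set_mult1:
  assumes "A \<subseteq> carrier G" "subgroup B G"
  shows "A \<subseteq> A <#> B"
proof
  fix a assume "a \<in> A"
  then show "a \<in> A <#> B"
    using assms subgroup.one_closed[OF assms(2)] unfolding set_mult_def by force
qed

lemma (in group) conjugate_set_mult_commuting:
  assumes "V \<subseteq> carrier G" "g \<in> carrier G" "h \<in> carrier G" "\<And>v. v \<in> V \<Longrightarrow> v \<otimes> h = h \<otimes> v"
    "g \<otimes> h = h \<otimes> g"
  shows "conjugate_set G V (g \<otimes> h) = conjugate_set G V g"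
  unfolding conjugate_set_def
proof (rule image_cong[OF refl])
  fix v assume v: "v \<in> V"
  then have vc: "v \<in> carrier G" using assms(1) by blast
  \<comment> \<open>Swapping \<open>g\<close> and \<open>h\<close> puts \<open>h\<close> next to
    \<open>v\<close>, with which it commutes, so that it cancels against
    \<open>inv h\<close>.\<close>
  have "inv (g \<otimes> h) \<otimes> v \<otimes> (g \<otimes> h) = inv (h \<otimes> g) \<otimes> v \<otimes> (h \<otimes> g)"
    using assms(5) by simp
  also have "\<dots> = inv g \<otimes> (inv h \<otimes> (v \<otimes> h)) \<otimes> g"
    using assms(2,3) vc by (simp add: inv_mult_group m_assoc)
  also have "\<dots> = inv g \<otimes> v \<otimes> g"
    using assms(2,3) vc v by (simp add: assms(4) m_assoc[symmetric])
  finally show "inv (g \<otimes> h) \<otimes> v \<otimes> (g \<otimes> h) = inv g \<otimes> v \<otimes> g" .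
qed

section \<open>Abnormality of a product and of its factors\<close>

text \<open>Serves both factors: \<open>W\<close> is the given subgroup of the other factor, and
  \<open>UW\<close> is the condition that the epimorphism later supplies.\<close>

lemma (in group) abnormal_factor_of_abnormal:
  assumes U: "subgroup U G" and V: "subgroup V (G\<lparr>carrier := U\<rparr>)" and W: "subgroup W G"
    and comm: "\<And>u w. \<lbrakk>u \<in> U; w \<in> W\<rbrakk> \<Longrightarrow> u \<otimes> w = w \<otimes> u"
    and abn: "abnormal (V <#> W) G"
    and UW: "U \<inter> W \<subseteq> V"
  shows "abnormal V (G\<lparr>carrier := U\<rparr>)"
  unfolding abnormal_in_subgroup_iff[OF U V]
proof
  fix g assume g: "g \<in> U"
  have VU: "V \<subseteq> U"
    using subgroup.subset[OF V] by simp
  note carr = subgroup.mem_carrier[OF U] subgroup.mem_carrier[OF W]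
  define K where "K = generate G (V \<union> conjugate_set G V g)"
  have gens: "V \<union> conjugate_set G V g \<subseteq> U"
    using g VU U
    by (auto simp: conjugate_set_def intro!: subgroup.m_closed subgroup.m_inv_closed)
  have KU: "K \<subseteq> U"
    unfolding K_def using gens U by (rule generate_subgroup_incl)
  have K: "subgroup K G"
    unfolding K_def using gens carr by (intro generate_is_subgroup) auto
  \<comment> \<open>This subgroup will contain both \<open>V <#> W\<close> and its conjugate by
    \<open>g\<close>, hence also what they generate.\<close>
  have KW: "subgroup (K <#> W) G"
    using K W comm KU by (intro subgroup_commuting_set_mult) auto
  have gen_K: "V \<subseteq> K" "conjugate_set G V g \<subseteq> K"
    unfolding K_def by (auto intro: generate.incl)
  have "conjugate_set G (V <#> W) g \<subseteq> K <#> W"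
  proof
    fix x assume "x \<in> conjugate_set G (V <#> W) g"
    then obtain v w where vw: "v \<in> V" "w \<in> W" "x = inv g \<otimes> (v \<otimes> w) \<otimes> g"
      by (auto simp: conjugate_set_def set_mult_def)
    have vc: "v \<in> carrier G"
      using vw VU carr by auto
    have "x = inv g \<otimes> v \<otimes> (w \<otimes> g)"
      using vw vc g carr by (simp add: m_assoc)
    \<comment> \<open>Since \<open>w\<close> commutes with \<open>g\<close>, the conjugation affects
      only \<open>v\<close>.\<close>
    also have "\<dots> = (inv g \<otimes> v \<otimes> g) \<otimes> w"
      using vw vc g carr comm[OF g] by (simp add: m_assoc)
    finally show "x \<in> K <#> W"
      using vw gen_K by (auto simp: set_mult_def conjugate_set_def)
  qed
  moreover have "V <#> W \<subseteq> K <#> W"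
    using gen_K by (intro mono_set_mult) auto
  ultimately have "generate G ((V <#> W) \<union> conjugate_set G (V <#> W) g) \<subseteq> K <#> W"
    using KW by (intro generate_subgroup_incl Un_least)
  then have "g \<in> K <#> W"
    using abn g carr by (auto simp: abnormal_def)
  then obtain k w where kw: "k \<in> K" "w \<in> W" "g = k \<otimes> w"
    by (auto simp: set_mult_def)
  \<comment> \<open>The error term \<open>w\<close> is a quotient of elements of \<open>U\<close>,
    so it lies in \<open>U \<inter> W\<close>, thus in \<open>V\<close> and in \<open>K\<close>;
    then \<open>g = k \<otimes> w\<close> lies in \<open>K\<close> as well.\<close>
  then have "w = inv k \<otimes> g"
    using KU carr by (metis inv_solve_left' m_closed subsetD)
  then have "w \<in> U"
    using kw(1) KU g U by (metis subgroup.m_closed subgroup.m_inv_closed subsetD)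
  then have "w \<in> K"
    using kw UW gen_K by blast
  then show "g \<in> generate G (V \<union> conjugate_set G V g)"
    using kw K subgroup.m_closed unfolding K_def by metis
qed

lemma (in group) abnormal_set_mult:
  assumes U1: "subgroup U\<^sub>1 G" and U2: "subgroup U\<^sub>2 G" and prod: "carrier G = U\<^sub>1 <#> U\<^sub>2"
    and comm: "\<And>x y. \<lbrakk>x \<in> U\<^sub>1; y \<in> U\<^sub>2\<rbrakk> \<Longrightarrow> x \<otimes> y = y \<otimes> x"
    and V1: "subgroup V\<^sub>1 (G\<lparr>carrier := U\<^sub>1\<rparr>)" and V2: "subgroup V\<^sub>2 (G\<lparr>carrier := U\<^sub>2\<rparr>)"
    and abn1: "abnormal V\<^sub>1 (G\<lparr>carrier := U\<^sub>1\<rparr>)" and abn2: "abnormal V\<^sub>2 (G\<lparr>carrier := U\<^sub>2\<rparr>)"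
  shows "abnormal (V\<^sub>1 <#> V\<^sub>2) G"
proof -
  define H where "H = V\<^sub>1 <#> V\<^sub>2"
  have VU: "V\<^sub>1 \<subseteq> U\<^sub>1" "V\<^sub>2 \<subseteq> U\<^sub>2"
    using subgroup.subset[OF V1] subgroup.subset[OF V2] by auto
  have V: "subgroup V\<^sub>1 G" "subgroup V\<^sub>2 G"
    using incl_subgroup U1 V1 U2 V2 by auto
  have H: "subgroup H G"
    unfolding H_def using V comm VU by (intro subgroup_commuting_set_mult) auto
  note carr = subgroup.mem_carrier[OF U1] subgroup.mem_carrier[OF U2]
  \<comment> \<open>\<open>subset_set_mult1\<close> embeds only the left factor, so both orders are
    needed.\<close>
  have "V\<^sub>1 <#> V\<^sub>2 = V\<^sub>2 <#> V\<^sub>1"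
    using comm VU by (intro commuting_set_mult_commute) auto
  then have VH: "V\<^sub>1 \<subseteq> H" "V\<^sub>2 \<subseteq> H"
    using subset_set_mult1 V subgroup.subset unfolding H_def by metis+
  have "g \<in> generate G (H \<union> conjugate_set G H g)" if g: "g \<in> carrier G" for g
  proof -
    obtain x y where xy: "x \<in> U\<^sub>1" "y \<in> U\<^sub>2" "g = x \<otimes> y"
      using g prod by (auto simp: set_mult_def)
    \<comment> \<open>For \<open>V\<^sub>2\<close> the factor to discard is \<open>x\<close>, and
      \<open>conjugate_set_mult_commuting\<close> discards the right-hand one.\<close>
    have yx: "g = y \<otimes> x"
      using xy comm by simp
    have "conjugate_set G V\<^sub>1 x = conjugate_set G V\<^sub>1 g"
      unfolding xy(3) using xy(1,2) VU carr
      by (intro conjugate_set_mult_commuting[symmetric]) (auto intro: comm)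
    then have sub1: "V\<^sub>1 \<union> conjugate_set G V\<^sub>1 x \<subseteq> H \<union> conjugate_set G H g"
      using VH by (auto simp: conjugate_set_def)
    have "conjugate_set G V\<^sub>2 y = conjugate_set G V\<^sub>2 g"
      unfolding yx using xy(1,2) VU carr
      by (intro conjugate_set_mult_commuting[symmetric]) (auto intro: comm[symmetric])
    then have sub2: "V\<^sub>2 \<union> conjugate_set G V\<^sub>2 y \<subseteq> H \<union> conjugate_set G H g"
      using VH by (auto simp: conjugate_set_def)
    have "x \<in> generate G (V\<^sub>1 \<union> conjugate_set G V\<^sub>1 x)"
      using abn1 xy abnormal_in_subgroup_iff[OF U1 V1] by blast
    moreover have "y \<in> generate G (V\<^sub>2 \<union> conjugate_set G V\<^sub>2 y)"
      using abn2 xy abnormal_in_subgroup_iff[OF U2 V2] by blast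
    ultimately show ?thesis
      unfolding xy(3) using mono_generate[OF sub1] mono_generate[OF sub2] xy(3)
      by (intro generate.eng) auto
  qed
  then show ?thesis
    using H unfolding abnormal_def H_def by blast
qed

section \<open>Recovering the subgroups of the factors from the epimorphism\<close>

lemma Int_eq_if_image_subset:
  assumes "finite V" "V \<subseteq> U \<inter> H" "U \<inter> H \<subseteq> f ` V"
  shows "U \<inter> H = V"
  by (metis assms card_image_le card_mono card_seteq finite_imageI finite_subset le_trans)

theorem theorem6p8:
  fixes G :: "('a, 'b) monoid_scheme"
    and D :: "('a \<times> 'a) monoid"
    and \<epsilon> :: "'a \<times> 'a \<Rightarrow> 'a"
    and U\<^sub>1 U\<^sub>2 V\<^sub>1 V\<^sub>2 H :: "'a set"
  assumes "group G" and "finite (carrier G)"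
    and "internal_central_product G U\<^sub>1 U\<^sub>2"
    and "solvable (G\<lparr>carrier := U\<^sub>1\<rparr>) \<or> solvable (G\<lparr>carrier := U\<^sub>2\<rparr>)"
    and "D = (G\<lparr>carrier := U\<^sub>1\<rparr>) \<times>\<times> (G\<lparr>carrier := U\<^sub>2\<rparr>)"
    and "\<epsilon> \<in> epi D G"
    and "\<epsilon> ` {(u, \<one>\<^bsub>G\<^esub>) | u. u \<in> U\<^sub>1} = U\<^sub>1"
    and "\<epsilon> ` {(\<one>\<^bsub>G\<^esub>, u) | u. u \<in> U\<^sub>2} = U\<^sub>2"
    and "subgroup H G" and "H = V\<^sub>1 <#>\<^bsub>G\<^esub> V\<^sub>2"
    and "subgroup V\<^sub>1 (G\<lparr>carrier := U\<^sub>1\<rparr>)" and "subgroup V\<^sub>2 (G\<lparr>carrier := U\<^sub>2\<rparr>)"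
    and "{x \<in> carrier D. \<epsilon> x \<in> H} = V\<^sub>1 \<times> V\<^sub>2"
    and "kernel D G \<epsilon> \<subseteq> V\<^sub>1 \<times> V\<^sub>2"
  shows "abnormal H G \<longleftrightarrow>
    abnormal V\<^sub>1 (G\<lparr>carrier := U\<^sub>1\<rparr>) \<and> abnormal V\<^sub>2 (G\<lparr>carrier := U\<^sub>2\<rparr>)"
proof -
  interpret group G by fact
  have U1: "subgroup U\<^sub>1 G" and U2: "subgroup U\<^sub>2 G" and prod: "carrier G = U\<^sub>1 <#>\<^bsub>G\<^esub> U\<^sub>2"
    and triv: "commutator_subgroup G U\<^sub>1 U\<^sub>2 = {\<one>\<^bsub>G\<^esub>}"
    using assms(3) by (auto simp: internal_central_product_def)
  note V1 = assms(11) and V2 = assms(12) and preimage = assms(13)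
  have comm: "x \<otimes>\<^bsub>G\<^esub> y = y \<otimes>\<^bsub>G\<^esub> x" if "x \<in> U\<^sub>1" "y \<in> U\<^sub>2" for x y
    using commute_if_commutator_subgroup_trivial[OF _ _ triv that] U1 U2 subgroup.subset by blast
  have VU: "V\<^sub>1 \<subseteq> U\<^sub>1" "V\<^sub>2 \<subseteq> U\<^sub>2"
    using subgroup.subset[OF V1] subgroup.subset[OF V2] by auto
  have V: "subgroup V\<^sub>1 G" "subgroup V\<^sub>2 G"
    using incl_subgroup U1 V1 U2 V2 by auto
  have fin: "finite V\<^sub>1" "finite V\<^sub>2"
    using V subgroup.subset assms(2) finite_subset by metis+
  have swap: "H = V\<^sub>2 <#>\<^bsub>G\<^esub> V\<^sub>1"
    using commuting_set_mult_commute[of V\<^sub>1 V\<^sub>2] comm VU assms(10) by blast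
  have VH: "V\<^sub>1 \<subseteq> H" "V\<^sub>2 \<subseteq> H"
    using subset_set_mult1 V subgroup.subset assms(10) swap by metis+
  have one: "\<one>\<^bsub>G\<^esub> \<in> U\<^sub>1" "\<one>\<^bsub>G\<^esub> \<in> U\<^sub>2"
    using U1 U2 subgroup.one_closed by auto
  \<comment> \<open>The map \<epsilon> sends the embedded copy of \<open>U\<^sub>1\<close> onto
    \<open>U\<^sub>1\<close> but may send \<open>(u, \<one>)\<close> to an element other than
    \<open>u\<close>. Only the first coordinate \<open>u\<close> of a preimage is known to lie in
    \<open>V\<^sub>1\<close>, so equality must come from finiteness.\<close>
  have "U\<^sub>1 \<inter> H \<subseteq> (\<lambda>u. \<epsilon> (u, \<one>\<^bsub>G\<^esub>)) ` V\<^sub>1"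
  proof
    fix x assume x: "x \<in> U\<^sub>1 \<inter> H"
    then obtain u where u: "u \<in> U\<^sub>1" "x = \<epsilon> (u, \<one>\<^bsub>G\<^esub>)"
      using assms(7) by blast
    then have "(u, \<one>\<^bsub>G\<^esub>) \<in> {x \<in> carrier D. \<epsilon> x \<in> H}"
      using x one assms(5) by (simp add: DirProd_def)
    then show "x \<in> (\<lambda>u. \<epsilon> (u, \<one>\<^bsub>G\<^esub>)) ` V\<^sub>1"
      using u preimage by blast
  qed
  then have int1: "U\<^sub>1 \<inter> H = V\<^sub>1"
    using fin VU VH by (intro Int_eq_if_image_subset) auto
  have "U\<^sub>2 \<inter> H \<subseteq> (\<lambda>u. \<epsilon> (\<one>\<^bsub>G\<^esub>, u)) ` V\<^sub>2"
  proof
    fix x assume x: "x \<in> U\<^sub>2 \<inter> H"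
    then obtain u where u: "u \<in> U\<^sub>2" "x = \<epsilon> (\<one>\<^bsub>G\<^esub>, u)"
      using assms(8) by blast
    then have "(\<one>\<^bsub>G\<^esub>, u) \<in> {x \<in> carrier D. \<epsilon> x \<in> H}"
      using x one assms(5) by (simp add: DirProd_def)
    then show "x \<in> (\<lambda>u. \<epsilon> (\<one>\<^bsub>G\<^esub>, u)) ` V\<^sub>2"
      using u preimage by blast
  qed
  then have int2: "U\<^sub>2 \<inter> H = V\<^sub>2"
    using fin VU VH by (intro Int_eq_if_image_subset) auto
  show ?thesis
  proof
    assume abn: "abnormal H G"
    \<comment> \<open>The intersection condition holds because \<open>V\<^sub>2\<close> lies in
      \<open>H\<close> and \<open>U\<^sub>1 \<inter> H = V\<^sub>1\<close>.\<close>
    have "abnormal V\<^sub>1 (G\<lparr>carrier := U\<^sub>1\<rparr>)"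
      by (rule abnormal_factor_of_abnormal[OF U1 V1 V(2)])
        (use abn assms(10) comm VU VH int1 in auto)
    moreover have "abnormal V\<^sub>2 (G\<lparr>carrier := U\<^sub>2\<rparr>)"
    proof (rule abnormal_factor_of_abnormal[OF U2 V2 V(1)])
      show "abnormal (V\<^sub>2 <#>\<^bsub>G\<^esub> V\<^sub>1) G"
        using abn swap by simp
      show "u \<otimes>\<^bsub>G\<^esub> w = w \<otimes>\<^bsub>G\<^esub> u" if "u \<in> U\<^sub>2" "w \<in> V\<^sub>1" for u w
        using that comm VU by (metis subsetD)
      show "U\<^sub>2 \<inter> V\<^sub>1 \<subseteq> V\<^sub>2"
        using int2 VH by blast
    qed
    ultimately show "abnormal V\<^sub>1 (G\<lparr>carrier := U\<^sub>1\<rparr>) \<and> abnormal V\<^sub>2 (G\<lparr>carrier := U\<^sub>2\<rparr>)" ..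
  next
    assume "abnormal V\<^sub>1 (G\<lparr>carrier := U\<^sub>1\<rparr>) \<and> abnormal V\<^sub>2 (G\<lparr>carrier := U\<^sub>2\<rparr>)"
    then show "abnormal H G"
      using abnormal_set_mult[OF U1 U2 prod comm V1 V2] assms(10) by simp
  qed
qed

end
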